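(* Let $(S,+,\circ)$ be a dual weak brace and $z\in\mathcal{D}_r(S)$. Let $r_z:S\times S\to S\times S$ be the map $$r_z(a,b)=\left(-a\circ z+a\circ b\circ z,\ \left(-a\circ z+a\circ b\circ z\right)^{-}\circ a\circ b\right),$$ and let $\check r_{z^-}:S\times S\to S\times S$ be the map $$\check r_{z^-}(a,b)=\left(a\circ b-a\circ z^-+z^-,\ \left(a\circ b-a\circ z^-+z^-\right)^{-}\circ a\circ b\right),$$ for all $a,b\in S$. Then $$r_z\,\check r_{z^-}\,r_z=r_z,\qquad \check r_{z^-}\,r_z\,\check r_{z^-}=\check r_{z^-},\qquad r_z\,\check r_{z^-}=\check r_{z^-}\,r_z.$$ Moreover, for every $a\in S$, $\sigma^z_a$ and $\tau^z_a$ are completely regular elements of the monoid of maps $S\to S$, since $$\sigma_a^{z}\sigma_{a^-}^{z^-}\sigma_a^{z}=\sigma_a^{z},\qquad \sigma_{a^-}^{z^-}\sigma_a^{z}\sigma_{a^-}^{z^-}=\sigma_{a^-}^{z^-},\qquad \sigma_{a}^{z}\sigma_{a^-}^{z^-}=\sigma_{a^-}^{z^-}\sigma_{a}^{z},$$ $$\tau_{a}^{z}\tau^{z}_{a^-}\tau_{a}^{z}=\tau_{a}^{z},\qquad \tau^{z}_{a^-}\tau_{a}^{z}\tau^{z}_{a^-}=\tau^{z}_{a^-},\qquad \tau^{z}_a\tau_{a^-}^{z}=\tau_{a^-}^{z}\tau_a^z.$$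
   Context: An inverse semigroup is a semigroup in which every element $a$ has a unique inverse $a'$ satisfying $a=aa'a$ and $a'=a'aa'$; it is a Clifford semigroup if moreover $aa'=a'a$ for every $a$. A weak (left) brace $(S,+,\circ)$ is a set $S$ with two binary operations such that $(S,+)$ and $(S,\circ)$ are inverse semigroups and, for all $a,b,c\in S$, $a\circ(b+c)=a\circ b-a+a\circ c$ and $a\circ a^-=-a+a$, where $-a$ and $a^-$ denote the inverses of $a$ in $(S,+)$ and $(S,\circ)$, respectively. The operation $+$ need not be commutative; $\circ$ binds more tightly than $+$ and $-$, so $-a\circ z$ means $-(a\circ z)$, and $x-y$ means $x+(-y)$. A weak brace is a dual weak brace if $(S,\circ)$ is a Clifford semigroup. The (right) distributor of $S$ is $\mathcal{D}_r(S)=\{z\in S\mid \forall a,b\in S\ \ (a+b)\circ z=a\circ z-z+b\circ z\}$. For $w\in S$ and $a,b\in S$, the maps $\sigma^w_a,\tau^w_b:S\to S$ are defined by $\sigma_a^{w}(b)=-a\circ w+a\circ b\circ w$ and $\tau_b^{w}(a)=\left(-a\circ w+a\circ b\circ w\right)^{-}\circ a\circ b$. Juxtaposition of maps is composition. An element $x$ of a monoid is completely regular if there is $y$ with $xyx=x$, $yxy=y$ and $xy=yx$. *)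

theory Defs
  imports Main
begin

definition is_semigroup_inverse :: "('a \<Rightarrow> 'a \<Rightarrow> 'a) \<Rightarrow> 'a \<Rightarrow> 'a \<Rightarrow> bool" where
  "is_semigroup_inverse f a a' \<longleftrightarrow> a = f (f a a') a \<and> a' = f (f a' a) a'"

(* The inverse of a for the operation f; meaningful when inverses are unique,
   i.e. in an inverse_semigroup. *)
definition sinv :: "('a \<Rightarrow> 'a \<Rightarrow> 'a) \<Rightarrow> 'a \<Rightarrow> 'a" where
  "sinv f a = (THE a'. is_semigroup_inverse f a a')"

locale inverse_semigroup = semigroup +
  assumes ex1_inverse: "\<exists>!a'. is_semigroup_inverse f a a'"

locale clifford_semigroup = inverse_semigroup +
  assumes inverse_comm: "f a (sinv f a) = f (sinv f a) a"

(* In what follows -a is sinv (\<oplus>) a, a - b is a \<oplus> sinv (\<oplus>) b, and the inverse of a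
   for the second operation is sinv (\<odot>) a. The operation \<oplus> is not assumed commutative. *)
locale weak_brace =
  add: inverse_semigroup add + mul: inverse_semigroup mul
  for add :: "'a \<Rightarrow> 'a \<Rightarrow> 'a" (infixl "\<oplus>" 65)
    and mul :: "'a \<Rightarrow> 'a \<Rightarrow> 'a" (infixl "\<odot>" 70) +
  assumes mul_add: "a \<odot> (b \<oplus> c) = a \<odot> b \<oplus> sinv (\<oplus>) a \<oplus> a \<odot> c"
    and mul_inverse: "a \<odot> sinv (\<odot>) a = sinv (\<oplus>) a \<oplus> a"

locale dual_weak_brace = weak_brace + mul: clifford_semigroup mul

context
  fixes add :: "'a \<Rightarrow> 'a \<Rightarrow> 'a" (infixl "\<oplus>" 65)
    and mul :: "'a \<Rightarrow> 'a \<Rightarrow> 'a" (infixl "\<odot>" 70)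
begin

definition right_distributor :: "'a set" where
  "right_distributor =
     {z. \<forall>a b. (a \<oplus> b) \<odot> z = a \<odot> z \<oplus> sinv (\<oplus>) z \<oplus> b \<odot> z}"

definition sigma :: "'a \<Rightarrow> 'a \<Rightarrow> 'a \<Rightarrow> 'a" where
  "sigma w a b = sinv (\<oplus>) (a \<odot> w) \<oplus> a \<odot> b \<odot> w"

(* Subscript first, argument last: tau w b is the map written with superscript w
   and subscript b, evaluated at a. *)
definition tau :: "'a \<Rightarrow> 'a \<Rightarrow> 'a \<Rightarrow> 'a" where
  "tau w b a = sinv (\<odot>) (sinv (\<oplus>) (a \<odot> w) \<oplus> a \<odot> b \<odot> w) \<odot> a \<odot> b"

definition r_map :: "'a \<Rightarrow> 'a \<times> 'a \<Rightarrow> 'a \<times> 'a" where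
  "r_map w = (\<lambda>(a, b).
     (sinv (\<oplus>) (a \<odot> w) \<oplus> a \<odot> b \<odot> w,
      sinv (\<odot>) (sinv (\<oplus>) (a \<odot> w) \<oplus> a \<odot> b \<odot> w) \<odot> a \<odot> b))"

definition r_check :: "'a \<Rightarrow> 'a \<times> 'a \<Rightarrow> 'a \<times> 'a" where
  "r_check w = (\<lambda>(a, b).
     (a \<odot> b \<oplus> sinv (\<oplus>) (a \<odot> w) \<oplus> w,
      sinv (\<odot>) (a \<odot> b \<oplus> sinv (\<oplus>) (a \<odot> w) \<oplus> w) \<odot> a \<odot> b))"

end

(* For maps on a type, f is instantiated with function composition. *)
definition completely_regular :: "('m \<Rightarrow> 'm \<Rightarrow> 'm) \<Rightarrow> 'm \<Rightarrow> bool" where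
  "completely_regular f x \<longleftrightarrow>
     (\<exists>y. f (f x y) x = x \<and> f (f y x) y = y \<and> f x y = f y x)"

end

theory Submission
  imports Defs
begin

text \<open>
  In a dual weak brace the two operations have the same idempotents, and adding an idempotent is
  the same as multiplying by it. This forces the additive semigroup to be Clifford as well, so
  that supports (the idempotents \<open>-a + a\<close>) are central and can be pulled out of every expression.
  Up to supports one computes as in a skew brace. There \<open>\<sigma>\<^sup>z\<^sub>a\<close> is the composition of
  \<open>b \<mapsto> -a + a \<circ> b\<close> and \<open>b \<mapsto> -z + b \<circ> z\<close>; the latter is additive for \<open>z\<close> in the distributor,
  and its inverse is the same map for \<open>z\<^sup>-\<close>. Hence in general each pair of maps composes, in
  either order, to the operation of adding the supports of the parameters involved. These supports
  are absorbed by the values of the maps, which gives complete regularity.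
\<close>

section \<open>Inverses and commuting idempotents in an inverse semigroup\<close>

context inverse_semigroup
begin

lemma is_inverse_sinv: "is_semigroup_inverse f a (sinv f a)"
  unfolding sinv_def by (rule theI') (rule ex1_inverse)

lemma sinv_unique: "is_semigroup_inverse f a b \<Longrightarrow> sinv f a = b"
  using ex1_inverse is_inverse_sinv by blast

lemma sinv_right: "a \<^bold>* (sinv f a \<^bold>* a) = a"
  using is_inverse_sinv[of a] by (simp add: is_semigroup_inverse_def assoc)

lemma sinv_left: "sinv f a \<^bold>* (a \<^bold>* sinv f a) = sinv f a"
  using is_inverse_sinv[of a] by (simp add: is_semigroup_inverse_def assoc)

lemma sinv_sinv: "sinv f (sinv f a) = a"
  by (rule sinv_unique) (simp add: is_semigroup_inverse_def assoc sinv_left sinv_right)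

lemma sinv_idem: "e \<^bold>* e = e \<Longrightarrow> sinv f e = e"
  by (rule sinv_unique) (simp add: is_semigroup_inverse_def)

lemma idem_sinv_left: "(sinv f a \<^bold>* a) \<^bold>* (sinv f a \<^bold>* a) = sinv f a \<^bold>* a"
  by (simp add: assoc sinv_right)

lemma idem_sinv_right: "(a \<^bold>* sinv f a) \<^bold>* (a \<^bold>* sinv f a) = a \<^bold>* sinv f a"
  by (simp add: assoc sinv_left)

text \<open>If x is the inverse of eg, then gxe is an inverse of eg as well, so x = gxe by
  uniqueness. This form makes x idempotent, hence equal to its own inverse, which is eg.\<close>

lemma idem_mult_closed:
  assumes e: "e \<^bold>* e = e" and g: "g \<^bold>* g = g"
  shows "(e \<^bold>* g) \<^bold>* (e \<^bold>* g) = e \<^bold>* g"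
proof -
  let ?x = "sinv f (e \<^bold>* g)"
  have ee: "e \<^bold>* (e \<^bold>* y) = e \<^bold>* y" and gg: "g \<^bold>* (g \<^bold>* y) = g \<^bold>* y" for y
    using e g by (metis assoc)+
  have 1: "e \<^bold>* (g \<^bold>* (?x \<^bold>* (e \<^bold>* g))) = e \<^bold>* g"
    using sinv_right[of "e \<^bold>* g"] by (simp add: assoc)
  have 2: "?x \<^bold>* (e \<^bold>* (g \<^bold>* ?x)) = ?x"
    using sinv_left[of "e \<^bold>* g"] by (simp add: assoc)
  have 3: "?x \<^bold>* (e \<^bold>* (g \<^bold>* (?x \<^bold>* y))) = ?x \<^bold>* y" for y
    using 2 by (metis assoc)
  have "is_semigroup_inverse f (e \<^bold>* g) (g \<^bold>* (?x \<^bold>* e))"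
    unfolding is_semigroup_inverse_def using 1 3 by (simp add: assoc ee gg)
  hence x: "?x = g \<^bold>* (?x \<^bold>* e)" by (rule sinv_unique)
  have "?x \<^bold>* ?x = (g \<^bold>* (?x \<^bold>* e)) \<^bold>* (g \<^bold>* (?x \<^bold>* e))" using x by simp
  also have "\<dots> = g \<^bold>* (?x \<^bold>* e)" using 3 by (simp add: assoc)
  finally have "?x \<^bold>* ?x = ?x" using x by simp
  hence "?x = e \<^bold>* g" using sinv_idem sinv_sinv by metis
  thus ?thesis using \<open>?x \<^bold>* ?x = ?x\<close> by simp
qed

text \<open>Since eg and ge are idempotent, ge is an inverse of eg; but the idempotent eg is its own
  inverse.\<close>

lemma idem_commute:
  assumes e: "e \<^bold>* e = e" and g: "g \<^bold>* g = g"
  shows "e \<^bold>* g = g \<^bold>* e"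
proof -
  have ee: "e \<^bold>* (e \<^bold>* y) = e \<^bold>* y" and gg: "g \<^bold>* (g \<^bold>* y) = g \<^bold>* y" for y
    using e g by (metis assoc)+
  have "is_semigroup_inverse f (e \<^bold>* g) (g \<^bold>* e)"
    unfolding is_semigroup_inverse_def
    using idem_mult_closed[OF e g] idem_mult_closed[OF g e] by (simp add: assoc ee gg)
  thus ?thesis using sinv_unique sinv_idem[OF idem_mult_closed[OF e g]] by metis
qed

text \<open>Between the outer factors stand the idempotents b b' and a' a; swapping them lets each
  variable cancel against its own inverse.\<close>

lemma sinv_mult: "sinv f (a \<^bold>* b) = sinv f b \<^bold>* sinv f a"
proof (rule sinv_unique)
  have c: "(b \<^bold>* sinv f b) \<^bold>* (sinv f a \<^bold>* a) = (sinv f a \<^bold>* a) \<^bold>* (b \<^bold>* sinv f b)"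
    by (rule idem_commute) (rule idem_sinv_right idem_sinv_left)+
  have "(a \<^bold>* b) \<^bold>* (sinv f b \<^bold>* sinv f a) \<^bold>* (a \<^bold>* b)
      = a \<^bold>* ((b \<^bold>* sinv f b) \<^bold>* (sinv f a \<^bold>* a)) \<^bold>* b" by (simp add: assoc)
  also have "\<dots> = (a \<^bold>* (sinv f a \<^bold>* a)) \<^bold>* (b \<^bold>* (sinv f b \<^bold>* b))"
    unfolding c by (simp add: assoc)
  finally have 1: "(a \<^bold>* b) \<^bold>* (sinv f b \<^bold>* sinv f a) \<^bold>* (a \<^bold>* b) = a \<^bold>* b"
    by (simp add: sinv_right)
  have "(sinv f b \<^bold>* sinv f a) \<^bold>* (a \<^bold>* b) \<^bold>* (sinv f b \<^bold>* sinv f a)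
      = sinv f b \<^bold>* ((sinv f a \<^bold>* a) \<^bold>* (b \<^bold>* sinv f b)) \<^bold>* sinv f a" by (simp add: assoc)
  also have "\<dots> = (sinv f b \<^bold>* (b \<^bold>* sinv f b)) \<^bold>* (sinv f a \<^bold>* (a \<^bold>* sinv f a))"
    unfolding c[symmetric] by (simp add: assoc)
  finally have 2: "(sinv f b \<^bold>* sinv f a) \<^bold>* (a \<^bold>* b) \<^bold>* (sinv f b \<^bold>* sinv f a)
      = sinv f b \<^bold>* sinv f a" by (simp add: sinv_left)
  show "is_semigroup_inverse f (a \<^bold>* b) (sinv f b \<^bold>* sinv f a)"
    unfolding is_semigroup_inverse_def using 1 2 by simp
qed

end

section \<open>Centrality of idempotents in a Clifford semigroup\<close>

context clifford_semigroup
begin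

text \<open>The Clifford identity is applied to ea as well: it yields e a a' = a' e a, which carries
  e from the left of a to its right.\<close>

lemma idem_central:
  assumes e: "e \<^bold>* e = e"
  shows "e \<^bold>* a = a \<^bold>* e"
proof -
  have ee: "e \<^bold>* (e \<^bold>* y) = e \<^bold>* y" for y using e by (metis assoc)
  have c: "e \<^bold>* (a \<^bold>* sinv f a) = (a \<^bold>* sinv f a) \<^bold>* e"
    by (rule idem_commute[OF e idem_sinv_right])
  have "e \<^bold>* (a \<^bold>* (sinv f a \<^bold>* e)) = sinv f a \<^bold>* (e \<^bold>* (e \<^bold>* a))"
    using inverse_comm[of "e \<^bold>* a"] by (simp add: sinv_mult sinv_idem[OF e] assoc)
  hence h: "e \<^bold>* (a \<^bold>* sinv f a) = sinv f a \<^bold>* (e \<^bold>* a)"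
    using c by (metis assoc e)
  have "e \<^bold>* a = (e \<^bold>* (a \<^bold>* sinv f a)) \<^bold>* a" by (simp add: assoc sinv_right)
  also have "\<dots> = a \<^bold>* (sinv f a \<^bold>* (e \<^bold>* a))" by (simp add: c assoc)
  also have "\<dots> = a \<^bold>* (e \<^bold>* (a \<^bold>* sinv f a))" by (simp add: h)
  also have "\<dots> = (a \<^bold>* (sinv f a \<^bold>* a)) \<^bold>* e"
    using c by (simp add: assoc inverse_comm)
  finally show ?thesis by (simp add: sinv_right)
qed

end

section \<open>Idempotents of a dual weak brace, and why addition is Clifford\<close>

context dual_weak_brace
begin

abbreviation neg ("\<ominus> _" [81] 80) where "\<ominus> a \<equiv> sinv (\<oplus>) a"
abbreviation inver ("_\<^sup>-" [90] 90) where "a\<^sup>- \<equiv> sinv (\<odot>) a"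

text \<open>For an idempotent of either operation, one side of \<open>mul_inverse\<close> collapses
  to \<open>e\<close>, and the other side is always idempotent for the other operation.\<close>

lemma idem_mul_iff_add: "e \<odot> e = e \<longleftrightarrow> e \<oplus> e = e"
proof
  assume "e \<odot> e = e"
  hence "e = \<ominus> e \<oplus> e" using mul_inverse[of e] mul.sinv_idem[of e] by simp
  thus "e \<oplus> e = e" using add.idem_sinv_left[of e] by simp
next
  assume "e \<oplus> e = e"
  hence "e = e \<odot> e\<^sup>-" using mul_inverse[of e] add.sinv_idem[of e] by simp
  thus "e \<odot> e = e" using mul.idem_sinv_right[of e] by simp
qed

text \<open>Both \<open>e \<odot> g\<close> and \<open>e \<odot> (e \<oplus> g)\<close> expand to
  \<open>e \<oplus> e \<odot> g\<close>. The second is \<open>e \<oplus> g\<close>, because that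
  idempotent lies below \<open>e\<close>.\<close>

lemma idem_mul_idem_eq_add:
  assumes e: "e \<oplus> e = e" and g: "g \<oplus> g = g"
  shows "e \<odot> g = e \<oplus> g"
proof -
  have below: "x \<odot> y = x" if x: "x \<oplus> x = x" and y: "y \<oplus> y = y" and "x \<oplus> y = x" for x y
  proof -
    have xx: "x \<odot> x = x" using x idem_mul_iff_add by simp
    have yy: "y \<odot> y = y" using y idem_mul_iff_add by simp
    have xy: "(x \<odot> y) \<oplus> (x \<odot> y) = x \<odot> y"
      using mul.idem_mult_closed[OF xx yy] idem_mul_iff_add by simp
    \<comment> \<open>Expanding \<open>x \<odot> (x \<oplus> y)\<close> and
      \<open>x \<odot> (y \<oplus> y)\<close> gives the same sum
      \<open>x \<oplus> x \<odot> y\<close>.\<close>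
    have "x = x \<odot> (x \<oplus> y)" using that xx by simp
    also have "\<dots> = x \<oplus> x \<odot> y" using mul_add[of x x y] xx x add.sinv_idem[OF x] by simp
    finally have 1: "x \<oplus> x \<odot> y = x" by simp
    have "x \<odot> y = x \<odot> (y \<oplus> y)" using y by simp
    also have "\<dots> = x \<oplus> x \<odot> y"
      using mul_add[of x y y] add.sinv_idem[OF x] add.idem_commute[OF x xy] xy
      by (metis add.assoc)
    finally show ?thesis using 1 by simp
  qed
  let ?h = "e \<oplus> g"
  have h: "?h \<oplus> ?h = ?h" using add.idem_mult_closed[OF e g] .
  have "?h \<oplus> e = ?h" using add.idem_commute[OF e g] e by (metis add.assoc)
  hence he: "?h \<odot> e = ?h" using below[OF h e] by simp
  have ee: "e \<odot> e = e" and gg: "g \<odot> g = g" using e g idem_mul_iff_add by auto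
  have "e \<odot> ?h = e \<oplus> e \<odot> g" using mul_add[of e e g] ee e add.sinv_idem[OF e] by simp
  moreover have "e \<odot> g = e \<oplus> e \<odot> g"
  proof -
    have eg: "(e \<odot> g) \<oplus> (e \<odot> g) = e \<odot> g"
      using mul.idem_mult_closed[OF ee gg] idem_mul_iff_add by simp
    have "e \<odot> g = e \<odot> g \<oplus> e \<oplus> e \<odot> g" using mul_add[of e g g] add.sinv_idem[OF e] g by simp
    thus ?thesis using add.idem_commute[OF e eg] eg by (metis add.assoc)
  qed
  ultimately have "e \<odot> g = e \<odot> ?h" by simp
  also have "\<dots> = ?h \<odot> e"
    using mul.idem_commute[OF ee] h idem_mul_iff_add by simp
  finally show ?thesis using he by simp
qed

lemma mul_idem_eq_add:
  assumes g: "g \<oplus> g = g"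
  shows "a \<odot> g = a \<oplus> g"
proof -
  define e where "e = \<ominus> a \<oplus> a"
  have e: "e \<oplus> e = e" unfolding e_def by (rule add.idem_sinv_left)
  have e': "e = a \<odot> a\<^sup>-" unfolding e_def by (simp add: mul_inverse)
  have gg: "g \<odot> g = g" using g idem_mul_iff_add by simp
  have ae: "a \<odot> e = a" unfolding e' by (simp add: mul.inverse_comm mul.sinv_right)
  have ae2: "a \<oplus> e = a" unfolding e_def by (simp add: add.sinv_right)
  let ?x = "a \<odot> g"
  \<comment> \<open>The product is \<open>a\<close> plus the idempotent \<open>?l\<close>, so it
    equals \<open>a\<close> plus its own support. That support, computed multiplicatively, is
    \<open>e \<oplus> g\<close>, and \<open>a\<close> absorbs \<open>e\<close>.\<close>
  let ?l = "\<ominus> a \<oplus> ?x"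
  have "?x = a \<odot> (e \<odot> g)" using ae by (metis mul.assoc)
  also have "\<dots> = a \<odot> (e \<oplus> g)" using idem_mul_idem_eq_add[OF e g] by simp
  also have "\<dots> = a \<oplus> ?l" by (simp add: mul_add ae add.assoc)
  finally have x: "?x = a \<oplus> ?l" .
  have "?x = ?x \<oplus> ?l" using mul_add[of a g g] g by (simp add: add.assoc)
  hence l: "?l \<oplus> ?l = ?l" by (metis add.assoc)
  have "\<ominus> ?x = ?l \<oplus> \<ominus> a"
    using add.sinv_mult[of a ?l] add.sinv_idem[OF l] x by simp
  hence "\<ominus> ?x \<oplus> ?x = ?l \<oplus> (e \<oplus> ?l)"
    using x unfolding e_def by (metis add.assoc)
  also have "\<dots> = e \<oplus> ?l" using add.idem_commute[OF e l] l by (metis add.assoc)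
  finally have "a \<oplus> (\<ominus> ?x \<oplus> ?x) = ?x" using x ae2 by (metis add.assoc)
  moreover have "\<ominus> ?x \<oplus> ?x = e \<oplus> g"
  proof -
    have "\<ominus> ?x \<oplus> ?x = a \<odot> (g \<odot> (g \<odot> a\<^sup>-))"
      by (simp add: mul_inverse[symmetric] mul.sinv_mult mul.sinv_idem[OF gg] mul.assoc)
    also have "\<dots> = e \<odot> g" using mul.idem_central[OF gg] gg e' by (metis mul.assoc)
    finally show ?thesis using idem_mul_idem_eq_add[OF e g] by simp
  qed
  ultimately show ?thesis using ae2 by (metis add.assoc)
qed

lemma neg_add_eq_add_neg: "a \<oplus> \<ominus> a = \<ominus> a \<oplus> a"
proof -
  txt \<open>The case \<open>a = -b\<close>, \<open>c = b\<close> of \<open>e \<circ> (a + c) = e \<circ> a - e + e \<circ> c\<close> for \<open>e = -b + b\<close>, where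
    \<open>e \<circ> x = x + e\<close>, shows that \<open>e\<close> is also a left additive unit of \<open>b\<close>.\<close>
  have fix_left: "\<ominus> b \<oplus> b \<oplus> b = b" for b
  proof -
    define e where "e = \<ominus> b \<oplus> b"
    have e: "e \<oplus> e = e" unfolding e_def by (rule add.idem_sinv_left)
    have ee: "e \<odot> e = e" using e idem_mul_iff_add by simp
    have m: "e \<odot> y = y \<oplus> e" for y
      using mul.idem_central[OF ee] mul_idem_eq_add[OF e] by simp
    have be: "b \<oplus> e = b" unfolding e_def by (simp add: add.sinv_right)
    have "e = e \<odot> (\<ominus> b \<oplus> b)" using ee e_def by simp
    also have "\<dots> = \<ominus> b \<oplus> e \<oplus> e \<oplus> (b \<oplus> e)" by (simp add: mul_add m add.sinv_idem[OF e])
    finally have "e = \<ominus> b \<oplus> (e \<oplus> b)" using e be by (metis add.assoc)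
    \<comment> \<open>Add \<open>b\<close> on the left; then \<open>e\<close> moves past the
      idempotent \<open>b \<oplus> \<ominus> b\<close>.\<close>
    hence "b = (b \<oplus> \<ominus> b) \<oplus> e \<oplus> b" using be by (metis add.assoc)
    also have "\<dots> = e \<oplus> (b \<oplus> \<ominus> b \<oplus> b)"
      using add.idem_commute[OF e add.idem_sinv_right[of b]] by (metis add.assoc)
    finally show ?thesis unfolding e_def by (simp add: add.assoc add.sinv_right)
  qed
  \<comment> \<open>Applied to \<open>a\<close> and to its negative, \<open>fix_left\<close> makes
    each of the two idempotents a left unit for the other; as they commute, they coincide.\<close>
  have 1: "(\<ominus> a \<oplus> a) \<oplus> (a \<oplus> \<ominus> a) = a \<oplus> \<ominus> a"
    using fix_left[of a] by (metis add.assoc)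
  have 2: "(a \<oplus> \<ominus> a) \<oplus> (\<ominus> a \<oplus> a) = \<ominus> a \<oplus> a"
    using fix_left[of "\<ominus> a"] by (metis add.assoc add.sinv_sinv)
  show ?thesis
    using 1 2 add.idem_commute[OF add.idem_sinv_left add.idem_sinv_right] by metis
qed

end

sublocale dual_weak_brace \<subseteq> add: clifford_semigroup add
  by unfold_locales (rule neg_add_eq_add_neg)

section \<open>Calculus of supports\<close>

context dual_weak_brace
begin

definition supp where "supp a = \<ominus> a \<oplus> a"

text \<open>A unary operator, so that the simplifier can pull supports outward through both
  operations and both inverses. Multiplying by \<open>supp a\<close> on either side gives the same
  operator.\<close>

definition restr where "restr a x = supp a \<oplus> x"

lemma supp_idem: "supp a \<oplus> supp a = supp a"
  unfolding supp_def by (rule add.idem_sinv_left)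

lemma supp_idem_mul: "supp a \<odot> supp a = supp a"
  using supp_idem idem_mul_iff_add by simp

lemma supp_central: "x \<oplus> supp a = supp a \<oplus> x"
  by (rule add.idem_central[OF supp_idem, symmetric])

lemma mul_supp: "x \<odot> supp a = restr a x"
  using mul_idem_eq_add[OF supp_idem] supp_central by (simp add: restr_def)

lemma supp_mul: "supp a \<odot> x = restr a x"
  using mul.idem_central[OF supp_idem_mul] mul_supp by simp

lemma add_supp: "x \<oplus> supp a = restr a x"
  by (simp add: restr_def supp_central)

lemma restr_add: "restr a x \<oplus> y = restr a (x \<oplus> y)"
  by (simp add: restr_def add.assoc)

lemma add_restr: "x \<oplus> restr a y = restr a (x \<oplus> y)"
  by (simp add: restr_def supp_central[of x] flip: add.assoc)

lemma restr_mul: "restr a x \<odot> y = restr a (x \<odot> y)"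
  by (simp add: mul.assoc flip: supp_mul)

lemma mul_restr: "x \<odot> restr a y = restr a (x \<odot> y)"
  by (simp add: mul.assoc flip: mul_supp)

lemma neg_restr: "\<ominus> (restr a x) = restr a (\<ominus> x)"
  by (simp add: restr_def add.sinv_mult add.sinv_idem[OF supp_idem] supp_central)

lemma inver_restr: "(restr a x)\<^sup>- = restr a (x\<^sup>-)"
  using mul.sinv_mult[of "supp a" x]
  by (simp add: supp_mul mul.sinv_idem[OF supp_idem_mul] mul_supp)

lemma restr_commute: "restr a (restr b x) = restr b (restr a x)"
  by (simp add: restr_def supp_central[of "supp a" b] flip: add.assoc)

lemma restr_restr: "restr a (restr a x) = restr a x"
  by (simp add: restr_def supp_idem flip: add.assoc)

lemma restr_self: "restr a a = a"
  using supp_central[of a a] add.sinv_right[of a] by (simp add: restr_def supp_def)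

lemma neg_add: "\<ominus> a \<oplus> a = supp a"
  by (simp add: supp_def)

lemma add_neg: "a \<oplus> \<ominus> a = supp a"
  by (simp add: supp_def add.inverse_comm)

lemma mul_inver: "a \<odot> a\<^sup>- = supp a"
  by (simp add: supp_def mul_inverse)

lemma inver_mul: "a\<^sup>- \<odot> a = supp a"
  using mul_inver mul.inverse_comm by simp

lemma neg_add_cancel: "\<ominus> a \<oplus> (a \<oplus> x) = restr a x"
  by (simp add: restr_def neg_add flip: add.assoc)

lemma add_neg_cancel: "a \<oplus> (\<ominus> a \<oplus> x) = restr a x"
  by (simp add: restr_def add_neg flip: add.assoc)

lemma mul_inver_cancel: "a \<odot> (a\<^sup>- \<odot> x) = restr a x"
  by (simp add: mul_inver supp_mul flip: mul.assoc)

lemma inver_mul_cancel: "a\<^sup>- \<odot> (a \<odot> x) = restr a x"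
  by (simp add: inver_mul supp_mul flip: mul.assoc)

lemma supp_supp: "supp (supp a) = supp a"
  by (simp add: supp_def[of "supp a"] add.sinv_idem supp_idem)

lemma supp_neg: "supp (\<ominus> a) = supp a"
  using neg_add[of "\<ominus> a"] by (simp add: add.sinv_sinv add_neg)

lemma supp_inver: "supp (a\<^sup>-) = supp a"
  using mul_inver[of "a\<^sup>-"] by (simp add: mul.sinv_sinv inver_mul)

lemma supp_add: "supp (a \<oplus> b) = restr a (supp b)"
  using neg_add[of "a \<oplus> b"]
  by (simp add: add.sinv_mult add.assoc neg_add_cancel add_restr neg_add)

lemma supp_mult: "supp (a \<odot> b) = restr a (supp b)"
  using mul_inver[of "a \<odot> b"]
  by (simp add: mul.sinv_mult mul.assoc mul_inver_cancel mul_restr mul_inver)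
    (simp add: restr_def supp_central[of "supp a" b])

lemma restr_add_left: "restr (a \<oplus> b) x = restr a (restr b x)"
  by (simp add: restr_def supp_add add.assoc)

lemma restr_mul_left: "restr (a \<odot> b) x = restr a (restr b x)"
  by (simp add: restr_def supp_mult add.assoc)

lemma restr_neg_left: "restr (\<ominus> a) x = restr a x"
  by (simp add: restr_def supp_neg)

lemma restr_inver_left: "restr (a\<^sup>-) x = restr a x"
  by (simp add: restr_def supp_inver)

lemma restr_restr_left: "restr (restr a b) x = restr a (restr b x)"
  by (simp add: restr_def supp_add supp_supp add.assoc)

lemma neg_supp: "\<ominus> supp a = supp a"
  by (rule add.sinv_idem[OF supp_idem])

lemma inver_supp: "(supp a)\<^sup>- = supp a"
  by (rule mul.sinv_idem[OF supp_idem_mul])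

lemma restr_supp_left: "restr (supp a) x = restr a x"
  by (simp add: restr_def supp_supp)

lemma restr_supp_self: "restr a (supp a) = supp a"
  by (simp add: restr_def supp_idem)

text \<open>As conditional rewrite rules these search an expression for a part that already carries
  the support of \<open>a\<close>, ending at \<open>restr_self\<close>. In this way the maps absorb
  the supports of their parameters.\<close>

lemma restr_absorb:
  assumes "restr a x = x"
  shows "restr a (restr b x) = restr b x"
    and "restr a (x \<oplus> y) = x \<oplus> y"
    and "restr a (y \<oplus> x) = y \<oplus> x"
    and "restr a (x \<odot> y) = x \<odot> y"
    and "restr a (y \<odot> x) = y \<odot> x"
    and "restr a (\<ominus> x) = \<ominus> x"
    and "restr a (x\<^sup>-) = x\<^sup>-"
  using assms restr_commute[of a b x] restr_add[of a x y] add_restr[of y a x]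
    restr_mul[of a x y] mul_restr[of y a x] neg_restr[of a x] inver_restr[of a x] by simp_all

lemmas restr_simps = restr_add add_restr restr_mul mul_restr neg_restr inver_restr
  restr_commute restr_restr restr_self restr_supp_self restr_absorb
  restr_add_left restr_mul_left restr_neg_left
  restr_inver_left restr_restr_left restr_supp_left
  neg_supp inver_supp mul_supp supp_mul add_supp restr_def[symmetric]

text \<open>Cancelling an inverse pair leaves a support behind, which \<open>restr_simps\<close>
  then moves outward, merges or absorbs.\<close>

lemmas cancel_simps = neg_add add_neg neg_add_cancel add_neg_cancel
  mul_inver inver_mul mul_inver_cancel inver_mul_cancel
  add.sinv_sinv mul.sinv_sinv add.sinv_mult mul.sinv_mult add.assoc mul.assoc

section \<open>Products with negatives, and inverses in the distributor\<close>

lemma mul_neg: "a \<odot> (\<ominus> b) = a \<oplus> (\<ominus> (a \<odot> b) \<oplus> a)"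
proof -
  \<comment> \<open>Expanding \<open>a \<odot> (b \<oplus> \<ominus> b \<oplus> b)\<close> and its
    counterpart with \<open>b\<close> negated shows that \<open>?y\<close> is the additive inverse
    of \<open>a \<odot> b\<close>. Adding \<open>a\<close> on both sides of \<open>?y\<close> then
    isolates the product.\<close>
  let ?y = "\<ominus> a \<oplus> (a \<odot> (\<ominus> b) \<oplus> \<ominus> a)"
  have "a \<odot> b = a \<odot> (b \<oplus> (\<ominus> b \<oplus> b))" by (simp add: add.sinv_right)
  also have "\<dots> = a \<odot> b \<oplus> (?y \<oplus> a \<odot> b)" by (simp add: mul_add add.assoc)
  finally have 1: "a \<odot> b = a \<odot> b \<oplus> (?y \<oplus> a \<odot> b)" .
  have "a \<odot> (\<ominus> b) = a \<odot> (\<ominus> b \<oplus> (b \<oplus> \<ominus> b))" by (simp add: add.sinv_left)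
  also have "\<dots> = a \<odot> (\<ominus> b) \<oplus> (\<ominus> a \<oplus> (a \<odot> b \<oplus> (\<ominus> a \<oplus> a \<odot> (\<ominus> b))))"
    by (simp add: mul_add add.assoc)
  finally have "?y = ?y \<oplus> (a \<odot> b \<oplus> ?y)" by (metis add.assoc)
  hence "\<ominus> (a \<odot> b) = ?y"
    using 1 by (intro add.sinv_unique) (simp add: is_semigroup_inverse_def add.assoc)
  thus ?thesis
    by (simp add: add_neg_cancel add.assoc neg_add restr_simps)
qed

lemma right_distributorD:
  "z \<in> right_distributor (\<oplus>) (\<odot>) \<Longrightarrow> (a \<oplus> b) \<odot> z = a \<odot> z \<oplus> (\<ominus> z \<oplus> b \<odot> z)"
  by (simp add: right_distributor_def add.assoc)

text \<open>The mirror image of \<open>mul_neg\<close>: the distributor condition replaces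
  \<open>mul_add\<close>, with \<open>z\<close> as right factor.\<close>

lemma neg_mul:
  assumes z: "z \<in> right_distributor (\<oplus>) (\<odot>)"
  shows "(\<ominus> a) \<odot> z = z \<oplus> (\<ominus> (a \<odot> z) \<oplus> z)"
proof -
  let ?y = "\<ominus> z \<oplus> ((\<ominus> a) \<odot> z \<oplus> \<ominus> z)"
  have "a \<odot> z = (a \<oplus> (\<ominus> a \<oplus> a)) \<odot> z" by (simp only: add.sinv_right)
  also have "\<dots> = a \<odot> z \<oplus> (?y \<oplus> a \<odot> z)" by (simp only: right_distributorD[OF z] add.assoc)
  finally have 1: "a \<odot> z = a \<odot> z \<oplus> (?y \<oplus> a \<odot> z)" .
  have "(\<ominus> a) \<odot> z = (\<ominus> a \<oplus> (a \<oplus> \<ominus> a)) \<odot> z" by (simp only: add.sinv_left)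
  also have "\<dots> = (\<ominus> a) \<odot> z \<oplus> (\<ominus> z \<oplus> (a \<odot> z \<oplus> (\<ominus> z \<oplus> (\<ominus> a) \<odot> z)))"
    by (simp only: right_distributorD[OF z] add.assoc)
  finally have "?y = ?y \<oplus> (a \<odot> z \<oplus> ?y)" by (metis add.assoc)
  hence "\<ominus> (a \<odot> z) = ?y"
    using 1 by (intro add.sinv_unique) (simp add: is_semigroup_inverse_def add.assoc)
  thus ?thesis
    by (simp add: add_neg_cancel add.assoc neg_add restr_simps)
qed

lemma inver_right_distributor:
  assumes z: "z \<in> right_distributor (\<oplus>) (\<odot>)"
  shows "z\<^sup>- \<in> right_distributor (\<oplus>) (\<odot>)"
proof -
  have "(a \<oplus> b) \<odot> z\<^sup>- = a \<odot> z\<^sup>- \<oplus> (\<ominus> (z\<^sup>-) \<oplus> b \<odot> z\<^sup>-)" (is "_ = ?r") for a b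
  proof -
    \<comment> \<open>The claim is checked after right multiplication by \<open>z\<close>.
      Multiplying back by \<open>z\<^sup>-\<close> costs only the support of \<open>z\<close>, which
      both sides carry.\<close>
    have "?r \<odot> z = restr z (a \<oplus> b)"
      by (simp add: right_distributorD[OF z] neg_mul[OF z] cancel_simps restr_simps)
    hence "(?r \<odot> z) \<odot> z\<^sup>- = restr z (a \<oplus> b) \<odot> z\<^sup>-" by simp
    hence "restr z ?r = restr z ((a \<oplus> b) \<odot> z\<^sup>-)"
      by (simp add: mul.assoc mul_inver mul_supp restr_mul)
    moreover have "restr z ?r = ?r"
      by (simp add: restr_simps)
    ultimately show ?thesis by (simp add: restr_simps)
  qed
  thus ?thesis by (simp add: right_distributor_def add.assoc)
qed

section \<open>Composites of the paired maps are additions of supports\<close>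

lemma sigma_sigma_inver:
  assumes z: "z \<in> right_distributor (\<oplus>) (\<odot>)"
  shows "sigma (\<oplus>) (\<odot>) z a (sigma (\<oplus>) (\<odot>) (z\<^sup>-) (a\<^sup>-) b) = restr a (restr z b)"
  \<comment> \<open>Up to supports, multiplying the inner value by \<open>a\<close> on the left and
    by \<open>z\<close> on the right gives \<open>a \<odot> z \<oplus> b\<close>, and the outer
    \<open>\<ominus> (a \<odot> z)\<close> cancels.\<close>
  by (simp add: sigma_def right_distributorD[OF z] neg_mul[OF z] mul_add mul_neg
      cancel_simps restr_simps)

lemma tau_tau_inver:
  "tau (\<oplus>) (\<odot>) z b (tau (\<oplus>) (\<odot>) z (b\<^sup>-) a) = restr b (restr z a)"
proof -
  define p q where "p = a \<odot> (b\<^sup>- \<odot> z)" and "q = a \<odot> z"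
  define c where "c = \<ominus> q \<oplus> p"
  define t where "t = c\<^sup>- \<odot> (a \<odot> b\<^sup>-)"
  \<comment> \<open>Evaluating \<open>c\<^sup>- \<odot> (\<ominus> c)\<close> directly and through
    \<open>\<ominus> c = \<ominus> p \<oplus> q\<close> gives the identity \<open>c\<close> below.
    It says that the outer sigma value at \<open>t\<close> is \<open>c\<^sup>-\<close> up to the
    support of \<open>b\<close>.\<close>
  have "c\<^sup>- \<odot> (\<ominus> c) = c\<^sup>- \<oplus> c\<^sup>-"
    by (simp add: mul_neg cancel_simps restr_simps)
  moreover have "c\<^sup>- \<odot> (\<ominus> c) = c\<^sup>- \<oplus> (\<ominus> (c\<^sup>- \<odot> p) \<oplus> c\<^sup>- \<odot> q)"
  proof -
    have "\<ominus> c = \<ominus> p \<oplus> q" by (simp add: c_def add.sinv_mult add.sinv_sinv)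
    moreover have "c\<^sup>- \<odot> (\<ominus> p \<oplus> q) = c\<^sup>- \<oplus> (\<ominus> (c\<^sup>- \<odot> p) \<oplus> c\<^sup>- \<odot> q)"
      by (simp add: mul_add mul_neg cancel_simps restr_simps)
    ultimately show ?thesis by simp
  qed
  ultimately have "\<ominus> (c\<^sup>-) \<oplus> (c\<^sup>- \<oplus> (\<ominus> (c\<^sup>- \<odot> p) \<oplus> c\<^sup>- \<odot> q)) = \<ominus> (c\<^sup>-) \<oplus> (c\<^sup>- \<oplus> c\<^sup>-)"
    by simp
  hence c: "\<ominus> (c\<^sup>- \<odot> p) \<oplus> c\<^sup>- \<odot> q = c\<^sup>-"
    by (simp add: neg_add_cancel restr_simps flip: neg_restr)
  have "tau (\<oplus>) (\<odot>) z (b\<^sup>-) a = t"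
    by (simp add: tau_def t_def c_def p_def q_def mul.assoc)
  moreover have "\<ominus> (t \<odot> z) \<oplus> t \<odot> b \<odot> z = restr b (c\<^sup>-)"
  proof -
    have "t \<odot> z = c\<^sup>- \<odot> p" by (simp add: t_def p_def mul.assoc)
    moreover have "t \<odot> b \<odot> z = restr b (c\<^sup>- \<odot> q)"
      by (simp add: t_def q_def cancel_simps restr_simps)
    ultimately show ?thesis using c by (simp add: add_restr)
  qed
  hence "tau (\<oplus>) (\<odot>) z b t = restr b (c \<odot> (t \<odot> b))"
    by (simp add: tau_def mul.assoc inver_restr restr_mul mul.sinv_sinv)
  \<comment> \<open>First \<open>c \<odot> c\<^sup>-\<close> cancels with \<open>c\<close> still
    folded; unfolding \<open>c\<close> afterwards shows its support to be composed of those of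
    \<open>a\<close>, \<open>b\<close> and \<open>z\<close>.\<close>
  moreover have "restr b (c \<odot> (t \<odot> b)) = restr b (restr z a)"
    by (simp add: t_def cancel_simps restr_simps) (simp add: c_def p_def q_def restr_simps)
  ultimately show ?thesis by simp
qed

text \<open>Both maps preserve \<open>a \<odot> b\<close> up to supports. If \<open>u\<close> is the
  first component of the inner value, \<open>u \<odot> z\<close> is
  \<open>a \<odot> b \<odot> z \<oplus> \<ominus> a\<close> up to supports, so the first component
  returns to \<open>a\<close>, and the preserved product then returns \<open>b\<close>.\<close>

lemma r_map_r_check:
  assumes z: "z \<in> right_distributor (\<oplus>) (\<odot>)"
  shows "r_map (\<oplus>) (\<odot>) z (r_check (\<oplus>) (\<odot>) (z\<^sup>-) (a, b))
    = (restr b (restr z a), restr a (restr z b))"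
  by (simp add: r_map_def r_check_def right_distributorD[OF z] neg_mul[OF z] mul_add mul_neg
      cancel_simps restr_simps)

lemma r_check_r_map:
  assumes z: "z \<in> right_distributor (\<oplus>) (\<odot>)"
  shows "r_check (\<oplus>) (\<odot>) (z\<^sup>-) (r_map (\<oplus>) (\<odot>) z (a, b))
    = (restr b (restr z a), restr a (restr z b))"
  by (simp add: r_map_def r_check_def right_distributorD[OF inver_right_distributor[OF z]]
      neg_mul[OF inver_right_distributor[OF z]] mul_add mul_neg
      cancel_simps restr_simps)

end



section \<open>Complete regularity by absorption of supports\<close>

theorem theorem2p10:
  fixes add mul :: "'a \<Rightarrow> 'a \<Rightarrow> 'a" and z :: 'a
  assumes "dual_weak_brace add mul"
    and "z \<in> right_distributor add mul"
  shows "r_map add mul z \<circ> r_check add mul (sinv mul z) \<circ> r_map add mul z = r_map add mul z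
    \<and> r_check add mul (sinv mul z) \<circ> r_map add mul z \<circ> r_check add mul (sinv mul z)
           = r_check add mul (sinv mul z)
    \<and> r_map add mul z \<circ> r_check add mul (sinv mul z)
           = r_check add mul (sinv mul z) \<circ> r_map add mul z
    \<and> (\<forall>a. completely_regular (\<circ>) (sigma add mul z a)
           \<and> completely_regular (\<circ>) (tau add mul z a))
    \<and> (\<forall>a. sigma add mul z a \<circ> sigma add mul (sinv mul z) (sinv mul a) \<circ> sigma add mul z a
               = sigma add mul z a
           \<and> sigma add mul (sinv mul z) (sinv mul a) \<circ> sigma add mul z a
               \<circ> sigma add mul (sinv mul z) (sinv mul a)
               = sigma add mul (sinv mul z) (sinv mul a)
           \<and> sigma add mul z a \<circ> sigma add mul (sinv mul z) (sinv mul a)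
               = sigma add mul (sinv mul z) (sinv mul a) \<circ> sigma add mul z a)
    \<and> (\<forall>a. tau add mul z a \<circ> tau add mul z (sinv mul a) \<circ> tau add mul z a = tau add mul z a
           \<and> tau add mul z (sinv mul a) \<circ> tau add mul z a \<circ> tau add mul z (sinv mul a)
               = tau add mul z (sinv mul a)
           \<and> tau add mul z a \<circ> tau add mul z (sinv mul a)
               = tau add mul z (sinv mul a) \<circ> tau add mul z a)"
proof -
  interpret dual_weak_brace add mul by fact
  note z = assms(2)
  let ?z = "sinv mul z"
  have z': "?z \<in> right_distributor add mul"
    by (rule inver_right_distributor[OF z])
  have r: "r_map add mul z \<circ> r_check add mul ?z = (\<lambda>(a, b). (restr b (restr z a), restr a (restr z b)))"
    "r_check add mul ?z \<circ> r_map add mul z = (\<lambda>(a, b). (restr b (restr z a), restr a (restr z b)))"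
    using r_map_r_check[OF z] r_check_r_map[OF z] by auto
  \<comment> \<open>Both components of each value already carry the supports of \<open>a\<close>,
    \<open>b\<close> and \<open>z\<close>, so adding supports changes nothing.\<close>
  have r_r: "r_map add mul z \<circ> r_check add mul ?z \<circ> r_map add mul z = r_map add mul z"
    "r_check add mul ?z \<circ> r_map add mul z \<circ> r_check add mul ?z = r_check add mul ?z"
    unfolding r
    by (auto simp: fun_eq_iff r_map_def r_check_def cancel_simps restr_simps)
  \<comment> \<open>The reverse order is the same lemma for \<open>?z\<close> and the inverse of
    \<open>a\<close>, whose supports are those of \<open>z\<close> and \<open>a\<close>.\<close>
  have s: "sigma add mul z a \<circ> sigma add mul ?z (sinv mul a) = restr a \<circ> restr z"
    "sigma add mul ?z (sinv mul a) \<circ> sigma add mul z a = restr a \<circ> restr z" for a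
    using sigma_sigma_inver[OF z, of a] sigma_sigma_inver[OF z', of "sinv mul a"]
    by (auto simp: mul.sinv_sinv restr_inver_left)
  have s_s: "sigma add mul z a \<circ> sigma add mul ?z (sinv mul a) \<circ> sigma add mul z a = sigma add mul z a"
    "sigma add mul ?z (sinv mul a) \<circ> sigma add mul z a \<circ> sigma add mul ?z (sinv mul a)
      = sigma add mul ?z (sinv mul a)" for a
    unfolding s by (auto simp: fun_eq_iff sigma_def cancel_simps restr_simps)
  have t: "tau add mul z a \<circ> tau add mul z (sinv mul a) = restr a \<circ> restr z"
    "tau add mul z (sinv mul a) \<circ> tau add mul z a = restr a \<circ> restr z" for a
    using tau_tau_inver[of z a] tau_tau_inver[of z "sinv mul a"]
    by (auto simp: mul.sinv_sinv restr_inver_left)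
  have t_t: "tau add mul z a \<circ> tau add mul z (sinv mul a) \<circ> tau add mul z a = tau add mul z a"
    "tau add mul z (sinv mul a) \<circ> tau add mul z a \<circ> tau add mul z (sinv mul a)
      = tau add mul z (sinv mul a)" for a
    unfolding t by (auto simp: fun_eq_iff tau_def cancel_simps restr_simps)
  have "completely_regular (\<circ>) (sigma add mul z a)" for a
    unfolding completely_regular_def
    by (intro exI[of _ "sigma add mul ?z (sinv mul a)"] conjI s_s) (simp only: s)
  moreover have "completely_regular (\<circ>) (tau add mul z a)" for a
    unfolding completely_regular_def
    by (intro exI[of _ "tau add mul z (sinv mul a)"] conjI t_t) (simp only: t)
  ultimately show ?thesis
    by (intro conjI allI r_r s_s t_t) (simp_all only: r s t)
qed

end
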